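(* Assume that $G_\xi$ is $L$-average Lipschitz continuous, i.e. $\mathbb{E}_\xi[\|G_\xi(x)-G_\xi(y)\|^2]\le L^2\|x-y\|^2$ for all $x,y$, and that $u_t:=G_{\zeta_t}(x_t)$ is an unbiased stochastic estimator of $G(x_t)$. Let $v_t$ be defined, for $t\ge1$, by $$v_t:=\beta_{t-1}v_{t-1}+\beta_{t-1}\big[G_{\xi_t}(x_t)-G_{\xi_t}(x_{t-1})\big]+(1-\beta_{t-1})u_t,\qquad \beta_{t-1}\in[0,1].$$ Then $$\mathbb{E}\big[\|v_t-G(x_t)\|^2\big]\le\omega_t\,\mathbb{E}\big[\|v_0-G(x_0)\|^2\big]+L^2\sum_{i=0}^{t-1}\omega_{i,t}\,\mathbb{E}\big[\|x_{i+1}-x_i\|^2\big]+S_t,$$ where the expectation is over all the randomness $\mathcal{F}_{t+1}:=\sigma(x_0,\xi_0,\zeta_0,\dots,\xi_t,\zeta_t)$ and $$\omega_t:=\prod_{i=1}^t\beta_{i-1}^2,\qquad \omega_{i,t}:=\prod_{j=i+1}^t\beta_{j-1}^2\ (i=0,\dots,t),\qquad S_t:=\sum_{i=0}^{t-1}\Big(\prod_{j=i+2}^t\beta_{j-1}^2\Big)(1-\beta_i)^2\,\mathbb{E}\big[\|u_{i+1}-G(x_{i+1})\|^2\big].$$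
   Context: $G(x):=\mathbb{E}_\xi[G_\xi(x)]$, where $G_\xi:\mathbb{R}^p\to\mathbb{R}^q$ depends on a random $\xi$ in a probability space $(\Omega,\mathbb{P})$. For each $t$, $\xi_t$ and $\zeta_t$ are two independent realizations of $\xi$, independent of the past $\mathcal{F}_t:=\sigma(x_0,\xi_0,\zeta_0,\dots,\xi_{t-1},\zeta_{t-1})$; the points $x_t$ and the estimator $v_{t-1}$ are $\mathcal{F}_t$-measurable. Empty products equal $1$ and empty sums equal $0$. The weights $\beta_t$ are deterministic. *)

theory Defs
  imports "HOL-Probability.Probability"
begin

definition mean_map :: "'z measure \<Rightarrow> ('z \<Rightarrow> real^'p \<Rightarrow> real^'q) \<Rightarrow> real^'p \<Rightarrow> real^'q" where
  "mean_map D G\<xi> y = (\<integral>z. G\<xi> z y \<partial>D)"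

text \<open>Expectations of squared norms are taken in \<open>[0,\<infinity>]\<close>, so that no second moment has
  to be assumed finite.\<close>

definition mean_sq :: "'a measure \<Rightarrow> ('a \<Rightarrow> real^'n) \<Rightarrow> ennreal" where
  "mean_sq M X = (\<integral>\<^sup>+\<omega>. ennreal ((norm (X \<omega>))\<^sup>2) \<partial>M)"

definition average_lipschitz :: "'z measure \<Rightarrow> ('z \<Rightarrow> real^'p \<Rightarrow> real^'q) \<Rightarrow> real \<Rightarrow> bool" where
  "average_lipschitz D G\<xi> L \<longleftrightarrow>
     (\<forall>y y'. mean_sq D (\<lambda>z. G\<xi> z y - G\<xi> z y') \<le> ennreal (L\<^sup>2 * (norm (y - y'))\<^sup>2))"

definition past ::
  "'a measure \<Rightarrow> 'z measure \<Rightarrow> ('a \<Rightarrow> real^'p) \<Rightarrow> (nat \<Rightarrow> 'a \<Rightarrow> 'z) \<Rightarrow> (nat \<Rightarrow> 'a \<Rightarrow> 'z) \<Rightarrow> nat \<Rightarrow> 'a measure"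
where
  "past M D x0 \<xi> \<zeta> t = sigma (space M)
     ({x0 -` A \<inter> space M |A. A \<in> sets borel} \<union>
      (\<Union>s<t. {\<xi> s -` A \<inter> space M |A. A \<in> sets D} \<union> {\<zeta> s -` A \<inter> space M |A. A \<in> sets D}))"

definition vec_cond_exp :: "'a measure \<Rightarrow> 'a measure \<Rightarrow> ('a \<Rightarrow> real^'n) \<Rightarrow> 'a \<Rightarrow> real^'n" where
  "vec_cond_exp M F X \<omega> = (\<chi> k. real_cond_exp M F (\<lambda>\<omega>'. X \<omega>' $ k) \<omega>)"

text \<open>No integrability of \<open>U\<close> is required: \<^const>\<open>real_cond_exp\<close> treats the positive and the
  negative part separately, so this is the generalized conditional expectation.\<close>

definition unbiased_given :: "'a measure \<Rightarrow> 'a measure \<Rightarrow> ('a \<Rightarrow> real^'n) \<Rightarrow> ('a \<Rightarrow> real^'n) \<Rightarrow> bool" where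
  "unbiased_given M F U Y \<longleftrightarrow> (AE \<omega> in M. vec_cond_exp M F U \<omega> = Y \<omega>)"

definition wt :: "(nat \<Rightarrow> real) \<Rightarrow> nat \<Rightarrow> real" where
  "wt \<beta> t = (\<Prod>i=1..t. (\<beta> (i - 1))\<^sup>2)"

definition wt_from :: "(nat \<Rightarrow> real) \<Rightarrow> nat \<Rightarrow> nat \<Rightarrow> real" where
  "wt_from \<beta> i t = (\<Prod>j=i+1..t. (\<beta> (j - 1))\<^sup>2)"

definition noise_sum ::
  "'a measure \<Rightarrow> (nat \<Rightarrow> real) \<Rightarrow> (nat \<Rightarrow> 'a \<Rightarrow> real^'q) \<Rightarrow> (real^'p \<Rightarrow> real^'q) \<Rightarrow> (nat \<Rightarrow> 'a \<Rightarrow> real^'p) \<Rightarrow> nat \<Rightarrow> ennreal"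
where
  "noise_sum M \<beta> u G x t =
     (\<Sum>i<t. ennreal ((\<Prod>j=i+2..t. (\<beta> (j - 1))\<^sup>2) * (1 - \<beta> i)\<^sup>2)
            * mean_sq M (\<lambda>\<omega>. u (i + 1) \<omega> - G (x (i + 1) \<omega>)))"

end

theory Submission
  imports Defs
begin

text \<open>
  Conditionally on the past, the error \<open>v\<^sub>s - G (x\<^sub>s)\<close> is the sum of the deterministic vector
  \<open>\<beta> (v\<^sub>s\<^sub>-\<^sub>1 - G (x\<^sub>s\<^sub>-\<^sub>1))\<close> and of two independent centred vectors, one driven by \<open>\<xi>\<^sub>s\<close> and one by
  \<open>\<zeta>\<^sub>s\<close>. Hence all cross terms vanish; the variance of the first centred vector is at most its
  second moment, which the average Lipschitz condition controls. Unrolling the resulting one-step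
  recursion gives the bound. Conditioning is carried out by Fubini on the joint law of the past and
  the fresh samples, so infinite second moments need no separate treatment beyond a case distinction.
\<close>

section \<open>Integrating out a sample that is independent of the past\<close>

text \<open>The predicate \<^const>\<open>prob_space.indep_var\<close> requires both variables to take values in
  the same type, so the product law is derived from \<^const>\<open>prob_space.indep_set\<close> directly.\<close>

lemma (in prob_space) distr_pair_subalgebra_indep:
  assumes F: "subalgebra M F" and Z[measurable]: "Z \<in> measurable M T"
    and indep: "indep_set (sets F) {Z -` A \<inter> space M |A. A \<in> sets T}"
  shows "distr M (F \<Otimes>\<^sub>M T) (\<lambda>\<omega>. (\<omega>, Z \<omega>)) = distr M F (\<lambda>\<omega>. \<omega>) \<Otimes>\<^sub>M distr M T Z"
proof -
  have sp: "space F = space M"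
    using F by (auto simp: subalgebra_def)
  have id[measurable]: "(\<lambda>\<omega>. \<omega>) \<in> measurable M F"
    using F by (rule measurable_from_subalg) simp
  interpret F: prob_space "distr M F (\<lambda>\<omega>. \<omega>)" by (rule prob_space_distr) fact
  interpret Z: prob_space "distr M T Z" by (rule prob_space_distr) fact
  show ?thesis
  \<comment> \<open>Rectangles determine a product of \<sigma>-finite measures. The graph map pulls
    \<open>A \<times> B\<close> back to the intersection of \<open>A\<close> with the event that
    \<open>Z\<close> lies in \<open>B\<close>, and independence factors its probability.\<close>
  proof (rule pair_measure_eqI[symmetric])
    show "sets (distr M F (\<lambda>\<omega>. \<omega>) \<Otimes>\<^sub>M distr M T Z) = sets (distr M (F \<Otimes>\<^sub>M T) (\<lambda>\<omega>. (\<omega>, Z \<omega>)))"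
      by (simp cong: sets_pair_measure_cong)
  next
    fix A B assume "A \<in> sets (distr M F (\<lambda>\<omega>. \<omega>))" "B \<in> sets (distr M T Z)"
    then have A: "A \<in> sets F" and B: "B \<in> sets T" by auto
    have A_sp: "A \<inter> space M = A"
      using sets.sets_into_space[OF A] by (auto simp: sp)
    have "emeasure (distr M (F \<Otimes>\<^sub>M T) (\<lambda>\<omega>. (\<omega>, Z \<omega>))) (A \<times> B) = emeasure M (A \<inter> (Z -` B \<inter> space M))"
      using A B by (subst emeasure_distr) (auto intro!: arg_cong[where f="emeasure M"] simp: A_sp)
    also have "\<dots> = ennreal (prob A * prob (Z -` B \<inter> space M))"
      using indep_setD[OF indep A, of "Z -` B \<inter> space M"] B by (auto simp: emeasure_eq_measure)
    also have "\<dots> = emeasure (distr M F (\<lambda>\<omega>. \<omega>)) A * emeasure (distr M T Z) B"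
      using A B by (simp add: emeasure_distr emeasure_eq_measure ennreal_mult A_sp)
    finally show "emeasure (distr M F (\<lambda>\<omega>. \<omega>)) A * emeasure (distr M T Z) B
        = emeasure (distr M (F \<Otimes>\<^sub>M T) (\<lambda>\<omega>. (\<omega>, Z \<omega>))) (A \<times> B)"
      by simp
  qed unfold_locales
qed

text \<open>Fubini for the product law of the past and \<open>Z\<close>: everything determined by
  \<open>F\<close> may be frozen while the fresh sample is averaged over its law. This takes the
  place of conditioning on \<open>F\<close>.\<close>

lemma (in prob_space) nn_integral_subalgebra_indep:
  assumes F: "subalgebra M F" and Z[measurable]: "Z \<in> measurable M T"
    and indep: "indep_set (sets F) {Z -` A \<inter> space M |A. A \<in> sets T}"
    and f: "f \<in> borel_measurable (F \<Otimes>\<^sub>M T)"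
  shows "(\<integral>\<^sup>+\<omega>. f (\<omega>, Z \<omega>) \<partial>M) = (\<integral>\<^sup>+\<omega>. (\<integral>\<^sup>+z. f (\<omega>, z) \<partial>distr M T Z) \<partial>M)"
proof -
  have id[measurable]: "(\<lambda>\<omega>. \<omega>) \<in> measurable M F"
    using F by (rule measurable_from_subalg) simp
  interpret Z: prob_space "distr M T Z" by (rule prob_space_distr) fact
  have f'[measurable]: "f \<in> borel_measurable (F \<Otimes>\<^sub>M distr M T Z)"
    using f by (simp cong: measurable_cong_sets)
  have f'': "f \<in> borel_measurable (distr M F (\<lambda>\<omega>. \<omega>) \<Otimes>\<^sub>M distr M T Z)"
    using f by (simp cong: measurable_cong_sets)
  have "(\<integral>\<^sup>+\<omega>. f (\<omega>, Z \<omega>) \<partial>M) = (\<integral>\<^sup>+p. f p \<partial>distr M (F \<Otimes>\<^sub>M T) (\<lambda>\<omega>. (\<omega>, Z \<omega>)))"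
    using f by (subst nn_integral_distr) auto
  also have "\<dots> = (\<integral>\<^sup>+a. (\<integral>\<^sup>+z. f (a, z) \<partial>distr M T Z) \<partial>distr M F (\<lambda>\<omega>. \<omega>))"
    unfolding distr_pair_subalgebra_indep[OF F Z indep] by (rule Z.nn_integral_fst[symmetric]) fact
  also have "\<dots> = (\<integral>\<^sup>+\<omega>. (\<integral>\<^sup>+z. f (\<omega>, z) \<partial>distr M T Z) \<partial>M)"
    by (rule nn_integral_distr) measurable
  finally show ?thesis .
qed

section \<open>The filtration of past observations\<close>

lemma subalgebra_past:
  assumes "x0 \<in> borel_measurable M" "\<And>s. \<xi> s \<in> measurable M D" "\<And>s. \<zeta> s \<in> measurable M D"
  shows "subalgebra M (past M D x0 \<xi> \<zeta> t)"
proof -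
  let ?A = "{x0 -` A \<inter> space M |A. A \<in> sets borel} \<union>
      (\<Union>s<t. {\<xi> s -` A \<inter> space M |A. A \<in> sets D} \<union> {\<zeta> s -` A \<inter> space M |A. A \<in> sets D})"
  have A: "?A \<subseteq> sets M"
    using assms by (auto intro: measurable_sets)
  then have "?A \<subseteq> Pow (space M)"
    using sets.space_closed by blast
  then show ?thesis
    using sets.sigma_sets_subset[OF A] by (simp add: subalgebra_def past_def)
qed

text \<open>The generators grow with time. This is what lets the older iterate be treated as known
  one step later.\<close>

lemma subalgebra_past_mono:
  assumes "x0 \<in> borel_measurable M" "\<And>s. \<xi> s \<in> measurable M D" "\<And>s. \<zeta> s \<in> measurable M D"
    and "s \<le> t"
  shows "subalgebra (past M D x0 \<xi> \<zeta> t) (past M D x0 \<xi> \<zeta> s)"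
proof -
  let ?A = "\<lambda>t. {x0 -` A \<inter> space M |A. A \<in> sets borel} \<union>
      (\<Union>s<t. {\<xi> s -` A \<inter> space M |A. A \<in> sets D} \<union> {\<zeta> s -` A \<inter> space M |A. A \<in> sets D})"
  have Pow: "?A r \<subseteq> Pow (space M)" for r
    by auto
  have "?A s \<subseteq> ?A t"
    using \<open>s \<le> t\<close> by (intro Un_mono UN_mono) auto
  then have "sigma_sets (space M) (?A s) \<subseteq> sigma_sets (space M) (?A t)"
    by (rule sigma_sets_mono')
  then show ?thesis
    by (simp only: subalgebra_def past_def sets_measure_of[OF Pow] space_measure_of[OF Pow] simp_thms)
qed

section \<open>Second moments of shifted and centred vectors\<close>

text \<open>The square is expanded; a finite second moment makes each of the three terms integrable.
  The instance \<open>c = 0\<close> converts the nonnegative integral of the squared norm into an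
  ordinary expectation.\<close>

lemma (in prob_space) nn_integral_norm_sq_add:
  fixes Y :: "'a \<Rightarrow> 'b :: euclidean_space"
  assumes Y: "integrable M Y" and fin: "(\<integral>\<^sup>+z. ennreal ((norm (Y z))\<^sup>2) \<partial>M) < \<infinity>"
  shows "(\<integral>\<^sup>+z. ennreal ((norm (c + Y z))\<^sup>2) \<partial>M)
    = ennreal ((norm c)\<^sup>2 + 2 * (c \<bullet> expectation Y) + expectation (\<lambda>z. (norm (Y z))\<^sup>2))"
proof -
  have Ym[measurable]: "Y \<in> borel_measurable M" using Y by auto
  have sq: "integrable M (\<lambda>z. (norm (Y z))\<^sup>2)"
    using fin by (intro integrableI_bounded) auto
  have eq: "(norm (c + Y z))\<^sup>2 = (norm c)\<^sup>2 + 2 * (c \<bullet> Y z) + (norm (Y z))\<^sup>2" for z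
    by (simp add: power2_norm_eq_inner inner_add inner_commute)
  have int: "integrable M (\<lambda>z. (norm (c + Y z))\<^sup>2)"
    unfolding eq using Y sq by auto
  have "(\<integral>\<^sup>+z. ennreal ((norm (c + Y z))\<^sup>2) \<partial>M) = ennreal (expectation (\<lambda>z. (norm (c + Y z))\<^sup>2))"
    using int by (rule nn_integral_eq_integral) simp
  also have "expectation (\<lambda>z. (norm (c + Y z))\<^sup>2)
      = (norm c)\<^sup>2 + 2 * (c \<bullet> expectation Y) + expectation (\<lambda>z. (norm (Y z))\<^sup>2)"
    unfolding eq using Y sq by (simp add: prob_space)
  finally show ?thesis .
qed

text \<open>The cross term is \<open>c\<close> paired with a zero mean. If the second moment is
  infinite, the right-hand side is \<infinity>.\<close>

lemma (in prob_space) nn_integral_norm_sq_add_centred_le: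
  fixes Y :: "'a \<Rightarrow> 'b :: euclidean_space"
  assumes Y: "integrable M Y" and "expectation Y = 0"
  shows "(\<integral>\<^sup>+z. ennreal ((norm (c + Y z))\<^sup>2) \<partial>M)
    \<le> ennreal ((norm c)\<^sup>2) + (\<integral>\<^sup>+z. ennreal ((norm (Y z))\<^sup>2) \<partial>M)"
proof (cases "(\<integral>\<^sup>+z. ennreal ((norm (Y z))\<^sup>2) \<partial>M) < \<infinity>")
  case True
  have "expectation (\<lambda>z. (norm (Y z))\<^sup>2) \<ge> 0" by simp
  then show ?thesis
    using nn_integral_norm_sq_add[OF Y True, of c] nn_integral_norm_sq_add[OF Y True, of 0] assms(2)
    by simp
next
  case False
  then show ?thesis by (simp add: top.not_eq_extremum[symmetric])
qed

lemma (in prob_space) nn_integral_variance_le: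
  fixes Y :: "'a \<Rightarrow> 'b :: euclidean_space"
  assumes Y: "integrable M Y"
  shows "(\<integral>\<^sup>+z. ennreal ((norm (Y z - expectation Y))\<^sup>2) \<partial>M) \<le> (\<integral>\<^sup>+z. ennreal ((norm (Y z))\<^sup>2) \<partial>M)"
proof (cases "(\<integral>\<^sup>+z. ennreal ((norm (Y z))\<^sup>2) \<partial>M) < \<infinity>")
  case True
  \<comment> \<open>With the shift \<open>c = - expectation Y\<close> the first two terms of the
    expansion add up to minus the squared norm of the mean.\<close>
  have "(norm (expectation Y))\<^sup>2 - 2 * (expectation Y \<bullet> expectation Y) \<le> 0"
    by (simp add: power2_norm_eq_inner)
  then show ?thesis
    using nn_integral_norm_sq_add[OF Y True, of "- expectation Y"] nn_integral_norm_sq_add[OF Y True, of 0]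
    by (auto intro!: ennreal_leI)
next
  case False
  then show ?thesis by (simp add: top.not_eq_extremum[symmetric])
qed

lemma nn_integral_norm_sq_scaleR:
  fixes Y :: "'a \<Rightarrow> 'b :: euclidean_space"
  assumes [measurable]: "Y \<in> borel_measurable M"
  shows "(\<integral>\<^sup>+z. ennreal ((norm (c *\<^sub>R Y z))\<^sup>2) \<partial>M) = ennreal (c\<^sup>2) * (\<integral>\<^sup>+z. ennreal ((norm (Y z))\<^sup>2) \<partial>M)"
  by (simp add: power_mult_distrib ennreal_mult nn_integral_cmult)

lemma (in prob_space) nn_integral_norm_sq_add_two_centred_le:
  fixes X Y :: "'a \<Rightarrow> 'b :: euclidean_space"
  assumes X: "integrable M X" "expectation X = 0" and Y: "integrable M Y" "expectation Y = 0"
  shows "(\<integral>\<^sup>+z. (\<integral>\<^sup>+w. ennreal ((norm (c + X z + Y w))\<^sup>2) \<partial>M) \<partial>M)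
    \<le> ennreal ((norm c)\<^sup>2) + (\<integral>\<^sup>+z. ennreal ((norm (X z))\<^sup>2) \<partial>M) + (\<integral>\<^sup>+w. ennreal ((norm (Y w))\<^sup>2) \<partial>M)"
proof -
  have [measurable]: "X \<in> borel_measurable M" using X by auto
  have "(\<integral>\<^sup>+z. (\<integral>\<^sup>+w. ennreal ((norm (c + X z + Y w))\<^sup>2) \<partial>M) \<partial>M)
      \<le> (\<integral>\<^sup>+z. ennreal ((norm (c + X z))\<^sup>2) + (\<integral>\<^sup>+w. ennreal ((norm (Y w))\<^sup>2) \<partial>M) \<partial>M)"
    by (intro nn_integral_mono nn_integral_norm_sq_add_centred_le Y)
  also have "\<dots> = (\<integral>\<^sup>+z. ennreal ((norm (c + X z))\<^sup>2) \<partial>M) + (\<integral>\<^sup>+w. ennreal ((norm (Y w))\<^sup>2) \<partial>M)"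
    by (subst nn_integral_add) (auto simp: emeasure_space_1)
  also have "\<dots> \<le> (ennreal ((norm c)\<^sup>2) + (\<integral>\<^sup>+z. ennreal ((norm (X z))\<^sup>2) \<partial>M))
      + (\<integral>\<^sup>+w. ennreal ((norm (Y w))\<^sup>2) \<partial>M)"
    by (intro add_right_mono nn_integral_norm_sq_add_centred_le X)
  finally show ?thesis .
qed

section \<open>Unrolling the scalar recursion\<close>

text \<open>Induction on \<open>t\<close>: multiplication by the new squared weight appends the
  factor \<open>j = t + 1\<close> to every product already present, and the last step contributes
  the summand \<open>i = t\<close>.\<close>

lemma unroll_linear_recursion:
  fixes a d n :: "nat \<Rightarrow> ennreal" and K :: ennreal
  assumes step: "\<And>s. a (Suc s) \<le> ennreal ((\<beta> s)\<^sup>2) * a s + ennreal ((\<beta> s)\<^sup>2) * (K * d s)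
      + ennreal ((1 - \<beta> s)\<^sup>2) * n s"
  shows "a t \<le> ennreal (wt \<beta> t) * a 0 + K * (\<Sum>i<t. ennreal (wt_from \<beta> i t) * d i)
      + (\<Sum>i<t. ennreal ((\<Prod>j=i+2..t. (\<beta> (j - 1))\<^sup>2) * (1 - \<beta> i)\<^sup>2) * n i)"
proof (induction t)
  case 0
  then show ?case by (simp add: wt_def)
next
  case (Suc t)
  let ?b = "ennreal ((\<beta> t)\<^sup>2)"
  let ?P = "\<lambda>i t. (\<Prod>j=i+2..t. (\<beta> (j - 1))\<^sup>2) * (1 - \<beta> i)\<^sup>2"
  have wt: "ennreal (wt \<beta> (Suc t)) = ?b * ennreal (wt \<beta> t)"
    by (simp add: wt_def ennreal_mult' mult.commute prod_nonneg)
  have wt_from: "ennreal (wt_from \<beta> i (Suc t)) = ?b * ennreal (wt_from \<beta> i t)" if "i < t" for i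
    using that by (simp add: wt_from_def ennreal_mult' mult.commute prod_nonneg)
  have P: "ennreal (?P i (Suc t)) = ?b * ennreal (?P i t)" if "i < t" for i
    using that by (subst ennreal_mult'[symmetric]) (auto simp: algebra_simps)
  \<comment> \<open>The new summand \<open>i = t\<close> has the single factor
    \<open>j = t + 1\<close>, which is the square of \<open>\<beta> t\<close>.\<close>
  have sum_from: "(\<Sum>i<Suc t. ennreal (wt_from \<beta> i (Suc t)) * d i)
      = ?b * (\<Sum>i<t. ennreal (wt_from \<beta> i t) * d i) + ?b * d t"
    by (simp add: wt_from sum_distrib_left mult.assoc) (simp add: wt_from_def)
  \<comment> \<open>Here the product for \<open>i = t\<close> runs from \<open>t + 2\<close> to
    \<open>t + 1\<close> and is empty, so the newest noise term is not damped by
    \<open>\<beta> t\<close>.\<close>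
  have sum_P: "(\<Sum>i<Suc t. ennreal (?P i (Suc t)) * n i)
      = ?b * (\<Sum>i<t. ennreal (?P i t) * n i) + ennreal ((1 - \<beta> t)\<^sup>2) * n t"
    using P by (simp add: sum_distrib_left mult.assoc)
  have "a (Suc t) \<le> ?b * a t + ?b * (K * d t) + ennreal ((1 - \<beta> t)\<^sup>2) * n t"
    by (rule step)
  also have "\<dots> \<le> ?b * (ennreal (wt \<beta> t) * a 0 + K * (\<Sum>i<t. ennreal (wt_from \<beta> i t) * d i)
      + (\<Sum>i<t. ennreal (?P i t) * n i)) + ?b * (K * d t) + ennreal ((1 - \<beta> t)\<^sup>2) * n t"
    by (intro add_right_mono mult_left_mono Suc.IH) simp
  also have "\<dots> = ennreal (wt \<beta> (Suc t)) * a 0 + K * (\<Sum>i<Suc t. ennreal (wt_from \<beta> i (Suc t)) * d i)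
      + (\<Sum>i<Suc t. ennreal (?P i (Suc t)) * n i)"
    unfolding sum_from sum_P wt by (simp add: algebra_simps)
  finally show ?case .
qed

section \<open>One-step error estimate and the final bound\<close>

theorem lemma2:
  fixes M :: "'a measure" and D :: "'z measure"
    and G\<xi> :: "'z \<Rightarrow> real^'p \<Rightarrow> real^'q" and G :: "real^'p \<Rightarrow> real^'q"
    and \<xi> \<zeta> :: "nat \<Rightarrow> 'a \<Rightarrow> 'z"
    and x :: "nat \<Rightarrow> 'a \<Rightarrow> real^'p" and u v :: "nat \<Rightarrow> 'a \<Rightarrow> real^'q"
    and \<beta> :: "nat \<Rightarrow> real" and L :: real and F :: "nat \<Rightarrow> 'a measure" and t :: nat
  assumes M: "prob_space M" and D: "prob_space D"
    and G\<xi>_measurable: "(\<lambda>(z, y). G\<xi> z y) \<in> borel_measurable (D \<Otimes>\<^sub>M borel)"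
    and G\<xi>_integrable: "\<And>y. integrable D (\<lambda>z. G\<xi> z y)"
    and G_def: "G = mean_map D G\<xi>"
    and \<xi>_measurable: "\<And>s. \<xi> s \<in> measurable M D" and \<xi>_law: "\<And>s. distr M D (\<xi> s) = D"
    and \<zeta>_measurable: "\<And>s. \<zeta> s \<in> measurable M D" and \<zeta>_law: "\<And>s. distr M D (\<zeta> s) = D"
    and x0_measurable: "x 0 \<in> borel_measurable M"
    and F_def: "F = past M D (x 0) \<xi> \<zeta>"
    and indep_\<xi>_\<zeta>: "\<And>s. prob_space.indep_var M D (\<xi> s) D (\<zeta> s)"
    and indep_past: "\<And>s. prob_space.indep_set M (sets (F s))
          {(\<lambda>\<omega>. (\<xi> s \<omega>, \<zeta> s \<omega>)) -` A \<inter> space M |A. A \<in> sets (D \<Otimes>\<^sub>M D)}"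
    and x_adapted: "\<And>s. x s \<in> borel_measurable (F s)"
    and v_adapted: "\<And>s. s \<ge> 1 \<Longrightarrow> v (s - 1) \<in> borel_measurable (F s)"
    and lipschitz: "average_lipschitz D G\<xi> L"
    and u_def: "\<And>s \<omega>. \<omega> \<in> space M \<Longrightarrow> u s \<omega> = G\<xi> (\<zeta> s \<omega>) (x s \<omega>)"
    and u_unbiased: "\<And>s. unbiased_given M (F s) (u s) (\<lambda>\<omega>. G (x s \<omega>))"
    and \<beta>_range: "\<And>s. s \<ge> 1 \<Longrightarrow> \<beta> (s - 1) \<in> {0..1}"
    and v_rec: "\<And>s \<omega>. s \<ge> 1 \<Longrightarrow> \<omega> \<in> space M \<Longrightarrow>
          v s \<omega> = \<beta> (s - 1) *\<^sub>R v (s - 1) \<omega>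
                + \<beta> (s - 1) *\<^sub>R (G\<xi> (\<xi> s \<omega>) (x s \<omega>) - G\<xi> (\<xi> s \<omega>) (x (s - 1) \<omega>))
                + (1 - \<beta> (s - 1)) *\<^sub>R u s \<omega>"
  shows "mean_sq M (\<lambda>\<omega>. v t \<omega> - G (x t \<omega>))
    \<le> ennreal (wt \<beta> t) * mean_sq M (\<lambda>\<omega>. v 0 \<omega> - G (x 0 \<omega>))
      + ennreal (L\<^sup>2) * (\<Sum>i<t. ennreal (wt_from \<beta> i t) * mean_sq M (\<lambda>\<omega>. x (i + 1) \<omega> - x i \<omega>))
      + noise_sum M \<beta> u G x t"
proof -
  interpret M: prob_space M by fact
  interpret D: prob_space D by fact
  note [measurable] = G\<xi>_measurable \<xi>_measurable \<zeta>_measurable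
  have G: "G y = (\<integral>z. G\<xi> z y \<partial>D)" for y
    by (simp add: G_def mean_map_def)
  have [measurable]: "G \<in> borel_measurable borel"
    unfolding G by measurable
  have sub: "subalgebra M (F s)" for s
    unfolding F_def by (rule subalgebra_past) (use x0_measurable \<xi>_measurable \<zeta>_measurable in auto)
  have step: "mean_sq M (\<lambda>\<omega>. v (Suc s) \<omega> - G (x (Suc s) \<omega>))
      \<le> ennreal ((\<beta> s)\<^sup>2) * mean_sq M (\<lambda>\<omega>. v s \<omega> - G (x s \<omega>))
        + ennreal ((\<beta> s)\<^sup>2) * (ennreal (L\<^sup>2) * mean_sq M (\<lambda>\<omega>. x (s + 1) \<omega> - x s \<omega>))
        + ennreal ((1 - \<beta> s)\<^sup>2) * mean_sq M (\<lambda>\<omega>. u (s + 1) \<omega> - G (x (s + 1) \<omega>))" for s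
  proof -
    let ?N = "F (Suc s)" and ?x = "x (Suc s)" and ?y = "x s" and ?b = "\<beta> s"
    let ?Z = "\<lambda>\<omega>. (\<xi> (Suc s) \<omega>, \<zeta> (Suc s) \<omega>)"
    have xN[measurable]: "?x \<in> borel_measurable ?N" by (rule x_adapted)
    \<comment> \<open>All of \<open>x (Suc s)\<close>, \<open>x s\<close> and \<open>v s\<close>
      have to be measurable for the same past \<open>F (Suc s)\<close>, so that they can be frozen
      together.\<close>
    have "subalgebra ?N (F s)"
      unfolding F_def
      by (rule subalgebra_past_mono) (use x0_measurable \<xi>_measurable \<zeta>_measurable in auto)
    then have yN[measurable]: "?y \<in> borel_measurable ?N"
      using x_adapted by (rule measurable_from_subalg)
    have vN[measurable]: "v s \<in> borel_measurable ?N"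
      using v_adapted[of "Suc s"] by simp
    have [measurable]: "?x \<in> borel_measurable M" "?y \<in> borel_measurable M" "v s \<in> borel_measurable M"
      using measurable_from_subalg[OF sub] xN yN vN by blast+
    \<comment> \<open>\<open>a\<close> is the previous error, \<open>X\<close> the centred increment
      and \<open>Y\<close> the centred fresh estimate. The sample is a separate argument, so that
      for fixed \<open>\<omega>\<close> both \<open>X \<omega>\<close> and \<open>Y \<omega>\<close>
      are random vectors on \<open>D\<close>.\<close>
    define a where "a = (\<lambda>\<omega>. v s \<omega> - G (?y \<omega>))"
    define X where "X = (\<lambda>\<omega> z. G\<xi> z (?x \<omega>) - G\<xi> z (?y \<omega>) - (G (?x \<omega>) - G (?y \<omega>)))"
    define Y where "Y = (\<lambda>\<omega> w. G\<xi> w (?x \<omega>) - G (?x \<omega>))"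
    have [measurable]: "a \<in> borel_measurable ?N" "a \<in> borel_measurable M"
      by (simp_all add: a_def)
    have [measurable]: "(\<lambda>(\<omega>, z). X \<omega> z) \<in> borel_measurable (?N \<Otimes>\<^sub>M D)"
        "(\<lambda>(\<omega>, z). Y \<omega> z) \<in> borel_measurable (?N \<Otimes>\<^sub>M D)"
        "(\<lambda>(\<omega>, z). Y \<omega> z) \<in> borel_measurable (M \<Otimes>\<^sub>M D)"
      unfolding X_def Y_def by measurable
    have X: "integrable D (X \<omega>)" "D.expectation (X \<omega>) = 0" for \<omega>
      using G\<xi>_integrable by (auto simp: X_def G D.prob_space)
    have Y: "integrable D (Y \<omega>)" "D.expectation (Y \<omega>) = 0" for \<omega>
      using G\<xi>_integrable by (auto simp: Y_def G D.prob_space)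

    have Z_m: "?Z \<in> measurable M (D \<Otimes>\<^sub>M D)" by measurable
    have Z_law: "distr M (D \<Otimes>\<^sub>M D) ?Z = D \<Otimes>\<^sub>M D"
      using indep_\<xi>_\<zeta>[of "Suc s"] by (simp add: M.indep_var_distribution_eq \<xi>_law \<zeta>_law)
    \<comment> \<open>The pair of new samples is independent of the past and has law
      \<open>D \<Otimes>\<^sub>M D\<close>, so averaging over it is a double integral over
      \<open>D\<close>.\<close>
    note fresh = M.nn_integral_subalgebra_indep[OF sub Z_m indep_past, unfolded Z_law]

    \<comment> \<open>The weights \<open>?b\<close> and \<open>1 - ?b\<close> sum to one, which
      splits \<open>G (?x \<omega>)\<close> between \<open>X\<close> and \<open>Y\<close>; the terms
      \<open>G (?y \<omega>)\<close> in \<open>a\<close> and \<open>X\<close> cancel.\<close>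
    have err: "v (Suc s) \<omega> - G (?x \<omega>)
        = ?b *\<^sub>R a \<omega> + ?b *\<^sub>R X \<omega> (\<xi> (Suc s) \<omega>) + (1 - ?b) *\<^sub>R Y \<omega> (\<zeta> (Suc s) \<omega>)"
      if "\<omega> \<in> space M" for \<omega>
      using v_rec[of "Suc s" \<omega>] u_def[of \<omega> "Suc s"] that
      by (simp add: a_def X_def Y_def algebra_simps)
    have noise: "mean_sq M (\<lambda>\<omega>. u (s + 1) \<omega> - G (x (s + 1) \<omega>))
        = (\<integral>\<^sup>+\<omega>. (\<integral>\<^sup>+w. ennreal ((norm (Y \<omega> w))\<^sup>2) \<partial>D) \<partial>M)"
    proof -
      have "mean_sq M (\<lambda>\<omega>. u (s + 1) \<omega> - G (x (s + 1) \<omega>))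
          = (\<integral>\<^sup>+\<omega>. (\<lambda>(\<omega>, z, w). ennreal ((norm (Y \<omega> w))\<^sup>2)) (\<omega>, ?Z \<omega>) \<partial>M)"
        unfolding mean_sq_def by (intro nn_integral_cong) (simp add: u_def Y_def)
      also have "\<dots> = (\<integral>\<^sup>+\<omega>. (\<integral>\<^sup>+p. (\<lambda>(\<omega>, z, w). ennreal ((norm (Y \<omega> w))\<^sup>2)) (\<omega>, p) \<partial>(D \<Otimes>\<^sub>M D)) \<partial>M)"
        by (rule fresh) measurable
      also have "\<dots> = (\<integral>\<^sup>+\<omega>. (\<integral>\<^sup>+w. ennreal ((norm (Y \<omega> w))\<^sup>2) \<partial>D) \<partial>M)"
      proof (intro nn_integral_cong)
        fix \<omega>
        have [measurable]: "Y \<omega> \<in> borel_measurable D" using Y by auto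
        show "(\<integral>\<^sup>+p. (\<lambda>(\<omega>, z, w). ennreal ((norm (Y \<omega> w))\<^sup>2)) (\<omega>, p) \<partial>(D \<Otimes>\<^sub>M D))
            = (\<integral>\<^sup>+w. ennreal ((norm (Y \<omega> w))\<^sup>2) \<partial>D)"
          \<comment> \<open>The integrand ignores the first sample, whose integral contributes the
            total mass 1.\<close>
          by (subst D.nn_integral_fst[symmetric]) (auto simp: D.emeasure_space_1)
      qed
      finally show ?thesis .
    qed
    \<comment> \<open>\<open>X \<omega>\<close> is the increment minus its mean, so its second
      moment is a variance. The Lipschitz condition, stated for deterministic points, applies
      because both iterates are frozen at \<open>\<omega>\<close>.\<close>
    have drift: "(\<integral>\<^sup>+z. ennreal ((norm (X \<omega> z))\<^sup>2) \<partial>D) \<le> ennreal (L\<^sup>2) * ennreal ((norm (?x \<omega> - ?y \<omega>))\<^sup>2)" for \<omega>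
    proof -
      have "(\<integral>\<^sup>+z. ennreal ((norm (X \<omega> z))\<^sup>2) \<partial>D)
          \<le> mean_sq D (\<lambda>z. G\<xi> z (?x \<omega>) - G\<xi> z (?y \<omega>))"
        using D.nn_integral_variance_le[of "\<lambda>z. G\<xi> z (?x \<omega>) - G\<xi> z (?y \<omega>)"] G\<xi>_integrable
        by (simp add: mean_sq_def X_def G)
      also have "\<dots> \<le> ennreal (L\<^sup>2 * (norm (?x \<omega> - ?y \<omega>))\<^sup>2)"
        using lipschitz by (simp add: average_lipschitz_def)
      finally show ?thesis by (simp add: ennreal_mult)
    qed
    have cond: "(\<integral>\<^sup>+p. ennreal ((norm (?b *\<^sub>R a \<omega> + ?b *\<^sub>R X \<omega> (fst p) + (1 - ?b) *\<^sub>R Y \<omega> (snd p)))\<^sup>2) \<partial>(D \<Otimes>\<^sub>M D))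
        \<le> ennreal (?b\<^sup>2) * ennreal ((norm (a \<omega>))\<^sup>2)
          + ennreal (?b\<^sup>2) * (ennreal (L\<^sup>2) * ennreal ((norm (?x \<omega> - ?y \<omega>))\<^sup>2))
          + ennreal ((1 - ?b)\<^sup>2) * (\<integral>\<^sup>+w. ennreal ((norm (Y \<omega> w))\<^sup>2) \<partial>D)" for \<omega>
    proof -
      have [measurable]: "X \<omega> \<in> borel_measurable D" "Y \<omega> \<in> borel_measurable D"
        using X Y by auto
      have "(\<integral>\<^sup>+p. ennreal ((norm (?b *\<^sub>R a \<omega> + ?b *\<^sub>R X \<omega> (fst p) + (1 - ?b) *\<^sub>R Y \<omega> (snd p)))\<^sup>2) \<partial>(D \<Otimes>\<^sub>M D))
          = (\<integral>\<^sup>+z. (\<integral>\<^sup>+w. ennreal ((norm (?b *\<^sub>R a \<omega> + ?b *\<^sub>R X \<omega> z + (1 - ?b) *\<^sub>R Y \<omega> w))\<^sup>2) \<partial>D) \<partial>D)"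
        by (subst D.nn_integral_fst[symmetric]) auto
      also have "\<dots> \<le> ennreal ((norm (?b *\<^sub>R a \<omega>))\<^sup>2) + (\<integral>\<^sup>+z. ennreal ((norm (?b *\<^sub>R X \<omega> z))\<^sup>2) \<partial>D)
          + (\<integral>\<^sup>+w. ennreal ((norm ((1 - ?b) *\<^sub>R Y \<omega> w))\<^sup>2) \<partial>D)"
        \<comment> \<open>Scaling keeps both vectors centred; the deterministic centre is
          \<open>?b *\<^sub>R a \<omega>\<close>.\<close>
        using X Y by (intro D.nn_integral_norm_sq_add_two_centred_le) auto
      also have "\<dots> = ennreal (?b\<^sup>2) * ennreal ((norm (a \<omega>))\<^sup>2)
          + ennreal (?b\<^sup>2) * (\<integral>\<^sup>+z. ennreal ((norm (X \<omega> z))\<^sup>2) \<partial>D)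
          + ennreal ((1 - ?b)\<^sup>2) * (\<integral>\<^sup>+w. ennreal ((norm (Y \<omega> w))\<^sup>2) \<partial>D)"
        by (subst (1 2) nn_integral_norm_sq_scaleR) (simp_all add: power_mult_distrib ennreal_mult)
      also have "\<dots> \<le> ennreal (?b\<^sup>2) * ennreal ((norm (a \<omega>))\<^sup>2)
          + ennreal (?b\<^sup>2) * (ennreal (L\<^sup>2) * ennreal ((norm (?x \<omega> - ?y \<omega>))\<^sup>2))
          + ennreal ((1 - ?b)\<^sup>2) * (\<integral>\<^sup>+w. ennreal ((norm (Y \<omega> w))\<^sup>2) \<partial>D)"
        by (intro add_mono order_refl mult_left_mono drift) simp
      finally show ?thesis .
    qed
    let ?f = "\<lambda>(\<omega>, z, w). ennreal ((norm (?b *\<^sub>R a \<omega> + ?b *\<^sub>R X \<omega> z + (1 - ?b) *\<^sub>R Y \<omega> w))\<^sup>2)"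
    have "mean_sq M (\<lambda>\<omega>. v (Suc s) \<omega> - G (?x \<omega>)) = (\<integral>\<^sup>+\<omega>. ?f (\<omega>, ?Z \<omega>) \<partial>M)"
      unfolding mean_sq_def by (intro nn_integral_cong) (simp add: err)
    also have "\<dots> = (\<integral>\<^sup>+\<omega>. (\<integral>\<^sup>+p. ?f (\<omega>, p) \<partial>(D \<Otimes>\<^sub>M D)) \<partial>M)"
      by (rule fresh) measurable
    also have "\<dots> \<le> (\<integral>\<^sup>+\<omega>. ennreal (?b\<^sup>2) * ennreal ((norm (a \<omega>))\<^sup>2)
        + ennreal (?b\<^sup>2) * (ennreal (L\<^sup>2) * ennreal ((norm (?x \<omega> - ?y \<omega>))\<^sup>2))
        + ennreal ((1 - ?b)\<^sup>2) * (\<integral>\<^sup>+w. ennreal ((norm (Y \<omega> w))\<^sup>2) \<partial>D) \<partial>M)"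
      using cond by (intro nn_integral_mono) (simp add: case_prod_beta)
    also have "\<dots> = ennreal (?b\<^sup>2) * mean_sq M a
        + ennreal (?b\<^sup>2) * (ennreal (L\<^sup>2) * mean_sq M (\<lambda>\<omega>. ?x \<omega> - ?y \<omega>))
        + ennreal ((1 - ?b)\<^sup>2) * (\<integral>\<^sup>+\<omega>. (\<integral>\<^sup>+w. ennreal ((norm (Y \<omega> w))\<^sup>2) \<partial>D) \<partial>M)"
      by (simp add: nn_integral_add nn_integral_cmult mean_sq_def)
    finally show ?thesis
      unfolding noise a_def by simp
  qed
  show ?thesis
    \<comment> \<open>The recursion is applied with \<open>K = ennreal (L\<^sup>2)\<close> and
      \<open>a s\<close> the mean squared error at time \<open>s\<close>; \<open>d s\<close> and
      \<open>n s\<close> are the squared displacement and the noise of the step from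
      \<open>s\<close> to \<open>s + 1\<close>.\<close>
    unfolding noise_sum_def by (rule unroll_linear_recursion) (rule step)
qed

end
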